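(* Let $\Xi=\{0,1\}$. Let $\Delta_{out_B}\in\{0,\dots,\Delta\}$. Let $B$ be an $\tilde n\times\tilde m$ rectangular subgraph of the grid with $x_{i,j}=0$ for all $(i,j)\in B$, and let $H_B$ be a subgraph of the grid with $|H_B|=\Delta_{out_B}$. Let $B$ and $H_B$ be disjoint. Then every feasible point $(d,\delta,\beta,\gamma)$ of (IP) fulfills $$c_\rho\sum_{(i,j)\in B}\delta_{i,j}\ \le\sum_{((i,j),(i+1,j))\in B\times B}\beta_{i,j}+\sum_{((i,j),(i,j+1))\in B\times B}\gamma_{i,j}+\bar M\Bigl(\Delta_{out_B}-\sum_{(i,j)\in H_B}\delta_{i,j}\Bigr)$$ with $$c_\rho:=\min_{0<K\le\Delta-\Delta_{out_B}}\frac{\min\bigl\{\lfloor\sqrt K\rceil+\lceil\sqrt K\rceil,\ \tilde n,\ \tilde m,\ \lfloor\sqrt{\tilde n\tilde m-K}\rceil+\lceil\sqrt{\tilde n\tilde m-K}\rceil\bigr\}}{K}$$ and $\bar M:=c_\rho+2$.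
   Context: Setting: $N,M\in\mathbb{N}$, $[N]:=\{1,\dots,N\}$, $x\in\Xi^{N\times M}$, $c\in\mathbb{R}^{N\times M}$, $\alpha>0$, $\Delta\in\mathbb{N}$. Notation: $\lfloor y\rceil$ is $y$ rounded to the nearest integer (ties rounded up), $\lceil y\rceil$ is $y$ rounded up. In the definition of $c_\rho$, $K$ stands for a number of nodes, i.e. it is an integer. (IP): minimize $\sum_{i=1}^N\sum_{j=1}^M c_{i,j}d_{i,j}+\alpha\bigl(\sum_{j=1}^M\sum_{i=1}^{N-1}\beta_{i,j}+\sum_{i=1}^N\sum_{j=1}^{M-1}\gamma_{i,j}\bigr)$ over $d\in\mathbb{Z}^{N\times M}$, $\delta\in\mathbb{R}^{N\times M}$, $\beta\in\mathbb{R}^{(N-1)\times M}$, $\gamma\in\mathbb{R}^{N\times(M-1)}$ subject to - $\min\Xi\le x_{i,j}+d_{i,j}\le\max\Xi$ for $i\in[N],j\in[M]$; - $-\beta_{i,j}\le x_{i+1,j}+d_{i+1,j}-x_{i,j}-d_{i,j}\le\beta_{i,j}$ for $i\in[N-1],j\in[M]$; - $-\gamma_{i,j}\le x_{i,j+1}+d_{i,j+1}-x_{i,j}-d_{i,j}\le\gamma_{i,j}$ for $i\in[N],j\in[M-1]$; - $-\delta_{i,j}\le d_{i,j}\le\delta_{i,j}$ for $i\in[N],j\in[M]$; - $\sum_{i=1}^N\sum_{j=1}^M\delta_{i,j}\le\Delta$. The grid is the graph with node set $[N]\times[M]$ in which two nodes are joined by an edge if they differ by exactly one in exactly one coordinate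 and agree in the other. Subgraphs are identified with their node sets (with all grid edges between their nodes), $|\cdot|$ is the number of nodes, and an $\tilde n\times\tilde m$ rectangular subgraph is the product of $\tilde n$ consecutive row indices and $\tilde m$ consecutive column indices. The sums over $((i,j),(i+1,j))\in B\times B$ and $((i,j),(i,j+1))\in B\times B$ run over all such pairs with both nodes in $B$.
   Formalization: The formal theorem adds δ=|d| on B and H_B (with slack in δ the claim fails, e.g. d=β=γ=0 and δ=1 at one node of B); in c_ρ, K is also at most ñm̃, so that the root is defined, and c_ρ=+∞ (with 0·∞=0) if Δ_out=Δ. *)

theory Defs
  imports "HOL-Library.Extended_Real"
begin

definition grid :: "nat \<Rightarrow> nat \<Rightarrow> (nat \<times> nat) set" where
  "grid N M = {1..N} \<times> {1..M}"

definition rectangular_subgraph ::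
  "nat \<Rightarrow> nat \<Rightarrow> nat \<Rightarrow> nat \<Rightarrow> (nat \<times> nat) set \<Rightarrow> bool" where
  "rectangular_subgraph N M n m B \<longleftrightarrow>
     1 \<le> n \<and> 1 \<le> m \<and> B \<subseteq> grid N M \<and> (\<exists>a b. B = {a..<a + n} \<times> {b..<b + m})"

(* The constraints only enforce \<bar>d\<bar> \<le> \<delta>. A feasible point may have slack in \<delta>, e.g. d = 0,
   \<beta> = \<gamma> = 0 and \<delta> = 1 at a single node, so results that use \<delta> as the absolute value of d
   need \<delta> = \<bar>d\<bar> as a separate assumption. *)
definition IP_feasible ::
  "int set \<Rightarrow> nat \<Rightarrow> nat \<Rightarrow> nat \<Rightarrow> (nat \<Rightarrow> nat \<Rightarrow> int) \<Rightarrow> (nat \<Rightarrow> nat \<Rightarrow> int) \<Rightarrow>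
   (nat \<Rightarrow> nat \<Rightarrow> real) \<Rightarrow> (nat \<Rightarrow> nat \<Rightarrow> real) \<Rightarrow> (nat \<Rightarrow> nat \<Rightarrow> real) \<Rightarrow> bool" where
  "IP_feasible \<Xi> N M \<Delta> x d \<delta> \<beta> \<gamma> \<longleftrightarrow>
     (\<forall>i\<in>{1..N}. \<forall>j\<in>{1..M}. Min \<Xi> \<le> x i j + d i j \<and> x i j + d i j \<le> Max \<Xi>) \<and>
     (\<forall>i\<in>{1..<N}. \<forall>j\<in>{1..M}.
        - \<beta> i j \<le> of_int (x (i + 1) j + d (i + 1) j - x i j - d i j) \<and>
        of_int (x (i + 1) j + d (i + 1) j - x i j - d i j) \<le> \<beta> i j) \<and>
     (\<forall>i\<in>{1..N}. \<forall>j\<in>{1..<M}.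
        - \<gamma> i j \<le> of_int (x i (j + 1) + d i (j + 1) - x i j - d i j) \<and>
        of_int (x i (j + 1) + d i (j + 1) - x i j - d i j) \<le> \<gamma> i j) \<and>
     (\<forall>i\<in>{1..N}. \<forall>j\<in>{1..M}. - \<delta> i j \<le> of_int (d i j) \<and> of_int (d i j) \<le> \<delta> i j) \<and>
     (\<Sum>i=1..N. \<Sum>j=1..M. \<delta> i j) \<le> real \<Delta>"

(* K counts nodes of the n \<times> m rectangle, and sqrt (n m - K) is meaningful only for K \<le> n m.
   For \<Delta>out = \<Delta> no K is admissible, and the minimum over the empty set is \<infinity>; this is why
   the value lies in ereal. Otherwise the infimum is a minimum over finitely many reals.
   The function round rounds ties up. *)
definition c_rho :: "nat \<Rightarrow> nat \<Rightarrow> nat \<Rightarrow> nat \<Rightarrow> ereal" where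
  "c_rho n m \<Delta> \<Delta>out =
     (INF K\<in>{K::nat. 0 < K \<and> K \<le> \<Delta> - \<Delta>out \<and> K \<le> n * m}.
        ereal (of_int (Min {round (sqrt (real K)) + \<lceil>sqrt (real K)\<rceil>,
                            int n, int m,
                            round (sqrt (real n * real m - real K))
                              + \<lceil>sqrt (real n * real m - real K)\<rceil>})
               / real K))"

definition M_bar :: "nat \<Rightarrow> nat \<Rightarrow> nat \<Rightarrow> nat \<Rightarrow> ereal" where
  "M_bar n m \<Delta> \<Delta>out = c_rho n m \<Delta> \<Delta>out + 2"

end

theory Submission
  imports Defs
begin

text \<open>
  On \<open>B\<close> the values \<open>d\<close> are the indicator of a node set \<open>S\<close>, say with \<open>k\<close> nodes, and the sums of
  \<open>\<beta>\<close> and \<open>\<gamma>\<close> over \<open>B\<close> bound from above the number of grid edges inside \<open>B\<close> that separate \<open>S\<close>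
  from \<open>B - S\<close>. The theorem rests on a discrete isoperimetric inequality for this number.

  Call a row or column of \<open>B\<close> mixed if it meets both \<open>S\<close> and \<open>B - S\<close>. Every mixed row or column
  contains a separating edge (\<open>card_jumping_lines_le\<close>), so if all rows are mixed, or all columns are,
  there are at least \<open>n\<close> or \<open>m\<close> separating edges. Otherwise some row and some column are constant.
  They cross, so they have the same value. If both miss \<open>S\<close>, every row and every column that meets
  \<open>S\<close> is mixed, so \<open>S\<close> lies in the product of the mixed rows and the mixed columns; if both lie in
  \<open>S\<close>, this holds for \<open>B - S\<close> (\<open>mixed_lines\<close>). A product of \<open>r\<close> rows and \<open>c\<close> columns with at least
  \<open>K\<close> nodes satisfies \<open>r + c \<ge> round (sqrt K) + \<lceil>sqrt K\<rceil>\<close> (\<open>half_perimeter_le\<close>). So the numerator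
  in \<open>c_rho\<close> at \<open>K = k\<close> bounds the number of separating edges from below.

  Let \<open>t\<close> be the number of nodes of \<open>H\<close> with \<open>d = 0\<close>. The budget constraint gives only
  \<open>k \<le> \<Delta> - \<Delta>out + t\<close>, so \<open>k\<close> need not be admissible in \<open>c_rho\<close>, but \<open>k - t\<close> is, unless
  \<open>k \<le> t\<close>. Passing from \<open>k\<close> to \<open>k - t\<close> raises the numerator by at most \<open>2 * t\<close>
  (\<open>half_perimeter_add_le\<close>), and the remaining \<open>t\<close> nodes cost \<open>c_rho * t\<close>. This is where the two
  summands of \<open>M_bar = c_rho + 2\<close> come from.
\<close>

section \<open>The half-perimeter of a rectangle with a given number of nodes\<close>

text \<open>
  This is the least \<open>r + c\<close> among the rectangles with \<open>r * c \<ge> K\<close>, and equals \<open>\<lceil>2 * sqrt K\<rceil>\<close>.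
\<close>

definition half_perimeter :: "nat \<Rightarrow> int" where
  "half_perimeter K = round (sqrt (real K)) + \<lceil>sqrt (real K)\<rceil>"

lemma half_perimeter_nonneg: "0 \<le> half_perimeter K"
proof -
  have "round (0::real) \<le> round (sqrt (real K))"
    by (rule round_mono) simp
  moreover have "\<lceil>0::real\<rceil> \<le> \<lceil>sqrt (real K)\<rceil>"
    by (rule ceiling_mono) simp
  ultimately show ?thesis
    by (simp add: half_perimeter_def)
qed

lemma half_perimeter_mono: "K \<le> L \<Longrightarrow> half_perimeter K \<le> half_perimeter L"
  unfolding half_perimeter_def by (intro add_mono round_mono ceiling_mono) auto

text \<open>
  The function \<open>sqrt\<close> is subadditive and at most the identity on natural numbers, so each of the
  two summands grows by at most \<open>t\<close>. For \<open>K = 0\<close> and \<open>t = 1\<close> equality holds.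
\<close>

lemma half_perimeter_add_le: "half_perimeter (K + t) \<le> half_perimeter K + 2 * int t"
proof -
  have "sqrt (real t) \<le> real t"
    by (rule real_le_lsqrt) (auto simp: power2_eq_square mult_le_cancel_left1)
  moreover have "sqrt (real K + real t) \<le> sqrt (real K) + sqrt (real t)"
    by (rule sqrt_add_le_add_sqrt) auto
  ultimately have le: "sqrt (real (K + t)) \<le> sqrt (real K) + real_of_int (int t)"
    by simp
  have "round (sqrt (real (K + t))) \<le> round (sqrt (real K) + real_of_int (int t))"
    by (rule round_mono[OF le])
  also have "\<dots> = round (sqrt (real K)) + int t"
    unfolding round_def by (simp add: add.assoc[symmetric] add.commute[of _ "1/2"])
  finally have "round (sqrt (real (K + t))) \<le> round (sqrt (real K)) + int t" .
  moreover have "\<lceil>sqrt (real (K + t))\<rceil> \<le> \<lceil>sqrt (real K)\<rceil> + int t"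
    using ceiling_mono[OF le] by (simp only: ceiling_add_of_int)
  ultimately show ?thesis
    by (simp add: half_perimeter_def)
qed

text \<open>
  For a fixed sum \<open>r + c\<close> the product is largest if \<open>r\<close> and \<open>c\<close> differ by at most one. With
  \<open>r + c = 2 * q\<close> this gives \<open>sqrt K \<le> q\<close>, which bounds both summands by \<open>q\<close>. With
  \<open>r + c = 2 * q + 1\<close> it gives \<open>K \<le> q * (q + 1)\<close>, hence \<open>sqrt K < q + 1/2\<close>, so the rounded root is
  at most \<open>q\<close> and the ceiling at most \<open>q + 1\<close>.
\<close>

lemma half_perimeter_le:
  assumes "K \<le> r * c"
  shows "half_perimeter K \<le> int (r + c)"
proof -
  have "4 * (int r * int c) \<le> (int r + int c)\<^sup>2"
    using zero_le_power2[of "int r - int c"] by (simp add: power2_eq_square algebra_simps)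
  with assms have K: "4 * int K \<le> (int (r + c))\<^sup>2"
    by (smt (verit) of_nat_add of_nat_le_iff of_nat_mult)
  show ?thesis
  proof (cases "even (r + c)")
    case True
    then obtain q where q: "r + c = 2 * q" by blast
    have "int K \<le> (int q)\<^sup>2"
      using K by (simp add: q power_mult_distrib)
    then have "real K \<le> (real q)\<^sup>2"
      by (metis of_nat_le_iff of_nat_power)
    then have "sqrt (real K) \<le> real q"
      by (simp add: real_le_lsqrt)
    then have "round (sqrt (real K)) \<le> int q" "\<lceil>sqrt (real K)\<rceil> \<le> int q"
      using round_mono[of "sqrt (real K)" "real q"] by (auto simp: ceiling_le_iff)
    then show ?thesis
      by (simp add: half_perimeter_def q)
  next
    case False
    then obtain q where q: "r + c = 2 * q + 1" by (rule oddE)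
    have "4 * int K \<le> 4 * (int q * (int q + 1)) + 1"
      using K unfolding q by (simp add: power2_eq_square algebra_simps)
    then have "int K \<le> int q * (int q + 1)"
      by presburger
    then have "real K \<le> real q * (real q + 1)"
      by (metis (mono_tags, lifting) of_int_1 of_int_add of_int_le_iff of_int_mult of_int_of_nat_eq)
    then have "real K < (real q + 1 / 2)\<^sup>2"
      by (simp add: power2_eq_square algebra_simps)
    then have *: "sqrt (real K) < real q + 1 / 2"
      by (intro real_less_lsqrt) auto
    have "round (sqrt (real K)) \<le> int q"
      using * unfolding round_def by (simp add: floor_le_iff)
    moreover have "\<lceil>sqrt (real K)\<rceil> \<le> int q + 1"
      using * by (simp add: ceiling_le_iff)
    ultimately show ?thesis
      by (simp add: half_perimeter_def q)
  qed
qed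

section \<open>Separating edges in a rectangle\<close>

definition mixed_rows :: "'a set \<Rightarrow> 'b set \<Rightarrow> ('a \<times> 'b) set \<Rightarrow> 'a set" where
  "mixed_rows I J S = {i\<in>I. (\<exists>j\<in>J. (i, j) \<in> S) \<and> (\<exists>j\<in>J. (i, j) \<notin> S)}"

definition mixed_cols :: "'a set \<Rightarrow> 'b set \<Rightarrow> ('a \<times> 'b) set \<Rightarrow> 'b set" where
  "mixed_cols I J S = {j\<in>J. (\<exists>i\<in>I. (i, j) \<in> S) \<and> (\<exists>i\<in>I. (i, j) \<notin> S)}"

text \<open>
  A constant row and a constant column share a node, so they agree. The value that they do not
  take occurs only in mixed rows and mixed columns, because each other row or column meets the
  constant column or row.
\<close>

lemma mixed_lines:
  "mixed_rows I J S = I \<or> mixed_cols I J S = J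
   \<or> I \<times> J \<inter> S \<subseteq> mixed_rows I J S \<times> mixed_cols I J S
   \<or> I \<times> J - S \<subseteq> mixed_rows I J S \<times> mixed_cols I J S"
proof (cases "mixed_rows I J S = I \<or> mixed_cols I J S = J")
  case False
  then obtain i0 j0 where "i0 \<in> I" "i0 \<notin> mixed_rows I J S" "j0 \<in> J" "j0 \<notin> mixed_cols I J S"
    unfolding mixed_rows_def mixed_cols_def by blast
  then show ?thesis
    unfolding mixed_rows_def mixed_cols_def by (cases "(i0, j0) \<in> S") auto
qed auto

text \<open>
  The four cases of \<open>mixed_lines\<close> give the four terms of the minimum in \<open>c_rho\<close>. The summand
  \<open>2 * t\<close> pays for counting only \<open>K\<close> of the \<open>K + t\<close> nodes of \<open>S\<close>: only the last term can grow
  when \<open>t\<close> nodes are dropped from this count, because they are then added to the count of the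
  complement.
\<close>

lemma isoperimetric_mixed_lines:
  fixes I :: "'a set" and J :: "'b set"
  assumes fin: "finite I" "finite J" and S: "S \<subseteq> I \<times> J" and K: "card S = K + t"
  shows "Min {half_perimeter K, int (card I), int (card J),
              half_perimeter (card I * card J - K)}
         \<le> int (card (mixed_rows I J S)) + int (card (mixed_cols I J S)) + 2 * int t"
    (is "Min ?A \<le> ?P + _")
proof -
  let ?R = "mixed_rows I J S" and ?C = "mixed_cols I J S"
  have finRC: "finite (?R \<times> ?C)"
    using fin by (auto simp: mixed_rows_def mixed_cols_def)
  have finS: "finite S"
    using S fin finite_subset by blast
  have diff: "card (I \<times> J - S) = card I * card J - card S"
    using S finS by (simp add: card_Diff_subset card_cartesian_product)
  have le: "card S \<le> card I * card J"
    using card_mono[OF _ S] fin by (simp add: card_cartesian_product)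
  consider "?R = I" | "?C = J" | "S \<subseteq> ?R \<times> ?C" | "I \<times> J - S \<subseteq> ?R \<times> ?C"
    using mixed_lines[of I J S] S by (auto simp: Int_absorb1)
  then have "\<exists>v\<in>?A. v \<le> ?P + 2 * int t"
  proof cases
    case 3
    then have "card S \<le> card ?R * card ?C"
      using card_mono[OF finRC] by (simp add: card_cartesian_product)
    then have "half_perimeter K \<le> ?P"
      using half_perimeter_le half_perimeter_mono[of K "card S"] K by fastforce
    then show ?thesis by auto
  next
    case 4
    then have "card I * card J - card S \<le> card ?R * card ?C"
      using card_mono[OF finRC 4] diff by (simp add: card_cartesian_product)
    then have "half_perimeter (card I * card J - card S) \<le> ?P"
      using half_perimeter_le by fastforce
    moreover have "card I * card J - K = (card I * card J - card S) + t"
      using K le by simp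
    ultimately have "half_perimeter (card I * card J - K) \<le> ?P + 2 * int t"
      using half_perimeter_add_le[of "card I * card J - card S" t] by simp
    then show ?thesis by auto
  qed auto
  then show ?thesis
    by (meson Min_le finite.emptyI finite.insertI order_trans)
qed

text \<open>
  By telescoping, the steps between \<open>p\<close> and \<open>q\<close> add up to the jump. The other steps only enlarge
  the right-hand side, since \<open>step\<close> makes their weights nonnegative.
\<close>

lemma jump_le_sum_steps:
  fixes f w :: "nat \<Rightarrow> real"
  assumes step: "\<And>i. i \<in> {a..<b - 1} \<Longrightarrow> \<bar>f (Suc i) - f i\<bar> \<le> w i"
    and pq: "p \<in> {a..<b}" "q \<in> {a..<b}"
  shows "\<bar>f p - f q\<bar> \<le> (\<Sum>i\<in>{a..<b - 1}. w i)"
proof -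
  have ordered: "\<bar>f q - f p\<bar> \<le> (\<Sum>i\<in>{a..<b - 1}. w i)"
    if "p \<le> q" "a \<le> p" "q < b" for p q
  proof -
    have "\<bar>f q - f p\<bar> = \<bar>\<Sum>i\<in>{p..<q}. f (Suc i) - f i\<bar>"
      using that by (simp add: sum_Suc_diff')
    also have "\<dots> \<le> (\<Sum>i\<in>{p..<q}. \<bar>f (Suc i) - f i\<bar>)"
      by (rule sum_abs)
    also have "\<dots> \<le> (\<Sum>i\<in>{a..<b - 1}. \<bar>f (Suc i) - f i\<bar>)"
      using that by (intro sum_mono2) auto
    also have "\<dots> \<le> (\<Sum>i\<in>{a..<b - 1}. w i)"
      by (rule sum_mono) (rule step)
    finally show ?thesis .
  qed
  show ?thesis
    using ordered[of p q] ordered[of q p] pq by (cases "p \<le> q") (auto simp: abs_minus_commute)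
qed

text \<open>
  If \<open>w j\<close> are the weights on line \<open>j\<close>, every line on which \<open>f\<close> takes two values that differ by at
  least one contributes at least one to the total.
\<close>

lemma card_jumping_lines_le:
  fixes f w :: "'b \<Rightarrow> nat \<Rightarrow> real"
  assumes fin: "finite J" and T: "T \<subseteq> J"
    and step: "\<And>i j. i \<in> {a..<b - 1} \<Longrightarrow> j \<in> J \<Longrightarrow> \<bar>f j (Suc i) - f j i\<bar> \<le> w j i"
    and jump: "\<And>j. j \<in> T \<Longrightarrow> \<exists>p\<in>{a..<b}. \<exists>q\<in>{a..<b}. 1 \<le> \<bar>f j p - f j q\<bar>"
  shows "real (card T) \<le> (\<Sum>j\<in>J. \<Sum>i\<in>{a..<b - 1}. w j i)"
proof -
  have "real (card T) = (\<Sum>j\<in>T. 1)"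
    by simp
  also have "\<dots> \<le> (\<Sum>j\<in>T. \<Sum>i\<in>{a..<b - 1}. w j i)"
  proof (rule sum_mono)
    fix j assume j: "j \<in> T"
    from jump[OF this] obtain p q where "p \<in> {a..<b}" "q \<in> {a..<b}" "1 \<le> \<bar>f j p - f j q\<bar>"
      by blast
    moreover have "\<bar>f j p - f j q\<bar> \<le> (\<Sum>i\<in>{a..<b - 1}. w j i)"
      using step j T calculation by (intro jump_le_sum_steps) auto
    ultimately show "1 \<le> (\<Sum>i\<in>{a..<b - 1}. w j i)"
      by linarith
  qed
  also have "\<dots> \<le> (\<Sum>j\<in>J. \<Sum>i\<in>{a..<b - 1}. w j i)"
    using fin T step by (intro sum_mono2 sum_nonneg) (fastforce intro: order_trans[OF abs_ge_zero])+
  finally show ?thesis .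
qed

section \<open>The constant as an extended real\<close>

lemma c_rho_eq_infinity: "\<Delta> \<le> \<Delta>out \<Longrightarrow> c_rho n m \<Delta> \<Delta>out = \<infinity>"
proof -
  assume "\<Delta> \<le> \<Delta>out"
  then have "{K. 0 < K \<and> K \<le> \<Delta> - \<Delta>out \<and> K \<le> n * m} = {}"
    by auto
  then show ?thesis
    unfolding c_rho_def by (simp only: image_empty Inf_empty top_ereal_def)
qed

lemma c_rho_half_perimeter:
  "c_rho n m \<Delta> \<Delta>out =
     (INF K\<in>{K. 0 < K \<and> K \<le> \<Delta> - \<Delta>out \<and> K \<le> n * m}.
        ereal (of_int (Min {half_perimeter K, int n, int m, half_perimeter (n * m - K)}) / real K))"
  unfolding c_rho_def half_perimeter_def by (intro INF_cong) (auto simp: of_nat_diff)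

lemma c_rho_nonneg: "0 \<le> c_rho n m \<Delta> \<Delta>out"
  unfolding c_rho_half_perimeter
  by (rule INF_greatest) (auto intro!: divide_nonneg_nonneg simp: half_perimeter_nonneg)

lemma c_rho_le:
  assumes "0 < K" "K \<le> \<Delta> - \<Delta>out" "K \<le> n * m"
  shows "c_rho n m \<Delta> \<Delta>out
         \<le> ereal (of_int (Min {half_perimeter K, int n, int m, half_perimeter (n * m - K)}) / real K)"
  unfolding c_rho_half_perimeter by (rule INF_lower) (use assms in auto)

lemma c_rho_real:
  assumes "\<Delta>out < \<Delta>" "1 \<le> n" "1 \<le> m"
  obtains c where "c_rho n m \<Delta> \<Delta>out = ereal c" "0 \<le> c"
proof -
  have "c_rho n m \<Delta> \<Delta>out \<noteq> \<infinity>"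
    using c_rho_le[of 1 \<Delta> \<Delta>out n m] assms by (auto simp: Suc_le_eq)
  then show ?thesis
    using that c_rho_nonneg[of n m \<Delta> \<Delta>out] by (cases "c_rho n m \<Delta> \<Delta>out") auto
qed

text \<open>
  This step is the bookkeeping for the \<open>t\<close> unused nodes of \<open>H\<close>, with the isoperimetric inequality
  for a boundary of size at most \<open>P\<close> as the hypothesis \<open>iso\<close>. If the constant is
  infinite then \<open>k \<le> t\<close>, so either both products vanish or the right-hand side is infinite.
\<close>

lemma c_rho_mult_le:
  assumes "1 \<le> n" "1 \<le> m" and P: "0 \<le> P"
    and k: "k \<le> n * m" "k \<le> \<Delta> - \<Delta>out + t"
    and iso: "\<And>K. k = K + t \<Longrightarrow>
      of_int (Min {half_perimeter K, int n, int m, half_perimeter (n * m - K)}) \<le> P + 2 * real t"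
  shows "c_rho n m \<Delta> \<Delta>out * ereal (real k) \<le> ereal P + M_bar n m \<Delta> \<Delta>out * ereal (real t)"
proof (cases "\<Delta>out < \<Delta>")
  case False
  then have inf: "c_rho n m \<Delta> \<Delta>out = \<infinity>"
    by (simp add: c_rho_eq_infinity)
  show ?thesis
  proof (cases "t = 0")
    case True
    then show ?thesis using False k P by (simp flip: zero_ereal_def)
  next
    case False
    then show ?thesis by (simp add: M_bar_def inf)
  qed
next
  case True
  then obtain c where c: "c_rho n m \<Delta> \<Delta>out = ereal c" "0 \<le> c"
    using c_rho_real assms(1,2) by blast
  have "c * real k \<le> P + (c + 2) * real t"
  proof (cases "k \<le> t")
    case True
    then have "c * real k \<le> c * real t"
      using c(2) by (intro mult_left_mono) auto
    then show ?thesis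
      using P by (simp add: algebra_simps)
  next
    case False
    define K where "K = k - t"
    have K: "k = K + t" "0 < K" "K \<le> \<Delta> - \<Delta>out" "K \<le> n * m"
      using False k by (auto simp: K_def)
    have "c * real K \<le> of_int (Min {half_perimeter K, int n, int m, half_perimeter (n * m - K)})"
      using c_rho_le[OF K(2-4)] K(2) unfolding c by (simp add: pos_le_divide_eq del: Min_insert)
    also have "\<dots> \<le> P + 2 * real t"
      by (rule iso[OF K(1)])
    finally show ?thesis
      by (simp add: K(1) algebra_simps)
  qed
  then show ?thesis
    by (simp add: M_bar_def c numeral_eq_ereal)
qed

section \<open>The valid inequality\<close>

theorem theorem9:
  fixes N M \<Delta> \<Delta>out n m :: nat
    and x d :: "nat \<Rightarrow> nat \<Rightarrow> int"
    and \<delta> \<beta> \<gamma> :: "nat \<Rightarrow> nat \<Rightarrow> real"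
    and B H :: "(nat \<times> nat) set"
  assumes x: "\<forall>i\<in>{1..N}. \<forall>j\<in>{1..M}. x i j \<in> {0, 1}"
    and out: "\<Delta>out \<le> \<Delta>"
    and B: "rectangular_subgraph N M n m B"
    and x_B: "\<forall>(i, j)\<in>B. x i j = 0"
    and H: "H \<subseteq> grid N M" "card H = \<Delta>out"
    and disj: "B \<inter> H = {}"
    and feas: "IP_feasible {0, 1} N M \<Delta> x d \<delta> \<beta> \<gamma>"
    and no_slack: "\<forall>(i, j)\<in>B \<union> H. \<delta> i j = \<bar>of_int (d i j)\<bar>"
  shows "c_rho n m \<Delta> \<Delta>out * ereal (\<Sum>(i, j)\<in>B. \<delta> i j)
         \<le> ereal ((\<Sum>(i, j)\<in>{(i, j). (i, j) \<in> B \<and> (i + 1, j) \<in> B}. \<beta> i j)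
                 + (\<Sum>(i, j)\<in>{(i, j). (i, j) \<in> B \<and> (i, j + 1) \<in> B}. \<gamma> i j))
           + M_bar n m \<Delta> \<Delta>out * ereal (real \<Delta>out - (\<Sum>(i, j)\<in>H. \<delta> i j))"
proof -
  from B obtain a b where nm: "1 \<le> n" "1 \<le> m" and Bgrid: "B \<subseteq> grid N M"
    and Beq: "B = {a..<a + n} \<times> {b..<b + m}"
    unfolding rectangular_subgraph_def by blast
  let ?I = "{a..<a + n}" and ?J = "{b..<b + m}"
  have bounds: "i \<in> {1..N}" "j \<in> {1..M}" if "(i, j) \<in> B" for i j
    using that Bgrid by (auto simp: grid_def)
  have d01: "d i j \<in> {0, 1}" if "(i, j) \<in> B" for i j
  proof -
    have "0 \<le> x i j + d i j \<and> x i j + d i j \<le> 1"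
      using feas bounds[OF that] unfolding IP_feasible_def by auto
    with x_B that show ?thesis by auto
  qed
  define S where "S = {(i, j) \<in> B. d i j = 1}"
  define T where "T = {(i, j) \<in> H. d i j = 0}"
  have finB: "finite B" by (simp add: Beq)
  have finH: "finite H"
    using H(1) by (rule finite_subset) (simp add: grid_def)
  have S_sub: "S \<subseteq> ?I \<times> ?J" by (auto simp: S_def Beq)

  have sumB: "(\<Sum>(i, j)\<in>B. \<delta> i j) = real (card S)"
  proof -
    have "(\<Sum>(i, j)\<in>B. \<delta> i j) = (\<Sum>p\<in>B. if p \<in> S then 1 else 0)"
    proof (rule sum.cong[OF refl], clarify)
      fix i j assume "(i, j) \<in> B"
      with no_slack have "\<delta> i j = \<bar>of_int (d i j)\<bar>" by blast
      with d01[OF \<open>(i, j) \<in> B\<close>] \<open>(i, j) \<in> B\<close> show "\<delta> i j = (if (i, j) \<in> S then 1 else 0)"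
        by (auto simp: S_def)
    qed
    also have "\<dots> = real (card (B \<inter> S))"
      using finB by (simp add: sum.If_cases)
    also have "B \<inter> S = S" by (auto simp: S_def)
    finally show ?thesis .
  qed
  have sumH: "(\<Sum>(i, j)\<in>H. \<delta> i j) = real \<Delta>out - real (card T)"
  proof -
    have "(\<Sum>(i, j)\<in>H. \<delta> i j) = (\<Sum>p\<in>H. 1 - (if p \<in> T then 1 else 0))"
    proof (rule sum.cong[OF refl], clarify)
      fix i j assume ij: "(i, j) \<in> H"
      then have g: "i \<in> {1..N}" "j \<in> {1..M}"
        using H(1) by (auto simp: grid_def)
      have "0 \<le> x i j + d i j \<and> x i j + d i j \<le> 1" "x i j \<in> {0, 1}"
        using feas x g unfolding IP_feasible_def by auto
      then have "d i j \<in> {-1, 0, 1}" by auto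
      moreover have "\<delta> i j = \<bar>of_int (d i j)\<bar>"
        using no_slack ij by blast
      ultimately show "\<delta> i j = 1 - (if (i, j) \<in> T then 1 else 0)"
        using ij by (auto simp: T_def)
    qed
    also have "\<dots> = real (card H) - real (card (H \<inter> T))"
      using finH by (simp add: sum_subtractf sum.If_cases)
    also have "H \<inter> T = T" by (auto simp: T_def)
    finally show ?thesis by (simp add: H(2))
  qed

  have "(\<Sum>(i, j)\<in>B. \<delta> i j) + (\<Sum>(i, j)\<in>H. \<delta> i j) = (\<Sum>(i, j)\<in>B \<union> H. \<delta> i j)"
    using finB finH disj by (simp add: sum.union_disjoint)
  also have "\<dots> \<le> (\<Sum>(i, j)\<in>grid N M. \<delta> i j)"
  proof (rule sum_mono2)
    show "finite (grid N M)" by (simp add: grid_def)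
    show "B \<union> H \<subseteq> grid N M" using Bgrid H(1) by blast
    fix p assume "p \<in> grid N M - (B \<union> H)"
    then obtain i j where p: "p = (i, j)" "i \<in> {1..N}" "j \<in> {1..M}"
      by (auto simp: grid_def)
    have "- \<delta> i j \<le> of_int (d i j)" "of_int (d i j) \<le> \<delta> i j"
      using feas p unfolding IP_feasible_def by blast+
    then show "0 \<le> (case p of (i, j) \<Rightarrow> \<delta> i j)"
      using p by simp
  qed
  also have "\<dots> = (\<Sum>i=1..N. \<Sum>j=1..M. \<delta> i j)"
    by (simp add: grid_def sum.cartesian_product)
  also have "\<dots> \<le> real \<Delta>"
    using feas unfolding IP_feasible_def by blast
  finally have "real (card S) + real \<Delta>out \<le> real \<Delta> + real (card T)"
    unfolding sumB sumH by simp
  then have budget: "card S \<le> \<Delta> - \<Delta>out + card T"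
    using out by linarith

  have \<beta>: "\<bar>real_of_int (d (Suc i) j) - real_of_int (d i j)\<bar> \<le> \<beta> i j"
    if "i \<in> {a..<a + n - 1}" "j \<in> ?J" for i j
  proof -
    have in_B: "(i, j) \<in> B" "(Suc i, j) \<in> B"
      using that by (auto simp: Beq)
    then have "i \<in> {1..<N}" "j \<in> {1..M}"
      using bounds[OF in_B(1)] bounds[OF in_B(2)] by auto
    then have "- \<beta> i j \<le> of_int (x (i + 1) j + d (i + 1) j - x i j - d i j)"
      "of_int (x (i + 1) j + d (i + 1) j - x i j - d i j) \<le> \<beta> i j"
      using feas unfolding IP_feasible_def by blast+
    moreover have "x i j = 0" "x (Suc i) j = 0"
      using x_B in_B by auto
    ultimately show ?thesis by simp
  qed
  have \<gamma>: "\<bar>real_of_int (d i (Suc j)) - real_of_int (d i j)\<bar> \<le> \<gamma> i j"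
    if "j \<in> {b..<b + m - 1}" "i \<in> ?I" for i j
  proof -
    have in_B: "(i, j) \<in> B" "(i, Suc j) \<in> B"
      using that by (auto simp: Beq)
    then have "i \<in> {1..N}" "j \<in> {1..<M}"
      using bounds[OF in_B(1)] bounds[OF in_B(2)] by auto
    then have "- \<gamma> i j \<le> of_int (x i (j + 1) + d i (j + 1) - x i j - d i j)"
      "of_int (x i (j + 1) + d i (j + 1) - x i j - d i j) \<le> \<gamma> i j"
      using feas unfolding IP_feasible_def by blast+
    moreover have "x i j = 0" "x i (Suc j) = 0"
      using x_B in_B by auto
    ultimately show ?thesis by simp
  qed

  define V where "V = (\<Sum>(i, j)\<in>{(i, j). (i, j) \<in> B \<and> (i + 1, j) \<in> B}. \<beta> i j)"
  define W where "W = (\<Sum>(i, j)\<in>{(i, j). (i, j) \<in> B \<and> (i, j + 1) \<in> B}. \<gamma> i j)"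
  have "{(i, j). (i, j) \<in> B \<and> (i + 1, j) \<in> B} = {a..<a + n - 1} \<times> ?J"
    by (auto simp: Beq)
  then have "V = (\<Sum>i\<in>{a..<a + n - 1}. \<Sum>j\<in>?J. \<beta> i j)"
    by (simp add: V_def sum.cartesian_product)
  also have "\<dots> = (\<Sum>j\<in>?J. \<Sum>i\<in>{a..<a + n - 1}. \<beta> i j)"
    by (rule sum.swap)
  finally have V: "V = \<dots>" .
  have "{(i, j). (i, j) \<in> B \<and> (i, j + 1) \<in> B} = ?I \<times> {b..<b + m - 1}"
    by (auto simp: Beq)
  then have W: "W = (\<Sum>i\<in>?I. \<Sum>j\<in>{b..<b + m - 1}. \<gamma> i j)"
    by (simp add: W_def sum.cartesian_product)

  let ?R = "mixed_rows ?I ?J S" and ?C = "mixed_cols ?I ?J S"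
  have jump: "1 \<le> \<bar>real_of_int (d i j) - real_of_int (d i' j')\<bar>"
    if "(i, j) \<in> S" "(i', j') \<notin> S" "(i', j') \<in> B" for i j i' j'
    using that d01[of i' j'] by (auto simp: S_def)
  have cols: "real (card ?C) \<le> V"
    unfolding V
  proof (rule card_jumping_lines_le[where f = "\<lambda>j i. real_of_int (d i j)"])
    fix j assume "j \<in> ?C"
    then obtain p q where "p \<in> ?I" "q \<in> ?I" "j \<in> ?J" "(p, j) \<in> S" "(q, j) \<notin> S"
      unfolding mixed_cols_def by blast
    with jump[of p j q j] show
      "\<exists>p\<in>?I. \<exists>q\<in>?I. 1 \<le> \<bar>real_of_int (d p j) - real_of_int (d q j)\<bar>"
      unfolding Beq by blast
  qed (use \<beta> in \<open>auto simp: mixed_cols_def\<close>)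
  have rows: "real (card ?R) \<le> W"
    unfolding W
  proof (rule card_jumping_lines_le[where f = "\<lambda>i j. real_of_int (d i j)"])
    fix i assume "i \<in> ?R"
    then obtain p q where "p \<in> ?J" "q \<in> ?J" "i \<in> ?I" "(i, p) \<in> S" "(i, q) \<notin> S"
      unfolding mixed_rows_def by blast
    with jump[of i p i q] show
      "\<exists>p\<in>?J. \<exists>q\<in>?J. 1 \<le> \<bar>real_of_int (d i p) - real_of_int (d i q)\<bar>"
      unfolding Beq by blast
  qed (use \<gamma> in \<open>auto simp: mixed_rows_def\<close>)

  have "c_rho n m \<Delta> \<Delta>out * ereal (real (card S))
        \<le> ereal (V + W) + M_bar n m \<Delta> \<Delta>out * ereal (real (card T))"
  proof (rule c_rho_mult_le[OF nm _ _ budget])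
    show "0 \<le> V + W"
      using cols rows of_nat_0_le_iff[of "card ?C"] of_nat_0_le_iff[of "card ?R"] by linarith
    show "card S \<le> n * m"
      using card_mono[OF _ S_sub] by (simp add: card_cartesian_product)
    fix K assume "card S = K + card T"
    from isoperimetric_mixed_lines[OF _ _ S_sub this]
    have "Min {half_perimeter K, int n, int m, half_perimeter (n * m - K)}
          \<le> int (card ?R) + int (card ?C) + 2 * int (card T)"
      by (simp del: Min_insert)
    then have "real_of_int (Min {half_perimeter K, int n, int m, half_perimeter (n * m - K)})
          \<le> real (card ?R) + real (card ?C) + 2 * real (card T)"
      by linarith
    then show "real_of_int (Min {half_perimeter K, int n, int m, half_perimeter (n * m - K)})
          \<le> V + W + 2 * real (card T)"
      using cols rows by linarith
  qed
  then show ?thesis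
    unfolding sumB sumH V_def W_def by simp
qed

end
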